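(* Let $q\in\mathbb{C}$ with $0<|q|<1$ and let $n\ge1$ be an integer. Then $$\sum_{k=0}^{\lfloor n/2\rfloor}\mathcal{T}_{n}^{k}=\left(\left\lfloor\frac n2\right\rfloor-\frac n2+1\right)\mathcal{T}_{n}+\frac x2\,\frac{d\,\mathcal{T}_{n}}{dx},$$ where $\mathcal{T}_n=\mathcal{T}_n(x,s,q)$ is the $q$-Chebyshev polynomial of the first kind and $\mathcal{T}_n^k=\mathcal{T}_n^k(x,s,q)$ are the incomplete $q$-Chebyshev polynomials of the first kind.
   Context: Notation: $[n]_q=\frac{1-q^n}{1-q}$, $[0]_q=0$; $(a;q)_0=1$ and $(a;q)_n=\prod_{i=0}^{n-1}(1-q^i a)$; $\begin{bmatrix} n\\k\end{bmatrix}_q=\frac{(q;q)_n}{(q;q)_{n-k}(q;q)_k}$ for $0\le k\le n$, and it is $0$ for $n<k$. Here $x,s$ are indeterminates. The $q$-Chebyshev polynomials of the first kind are defined by $\mathcal{T}_0=1$, $\mathcal{T}_1=x$, $\mathcal{T}_{n}=(1+q^{n-1})x\,\mathcal{T}_{n-1}+q^{n-1}s\,\mathcal{T}_{n-2}$ for $n\ge2$; it is known that $$\mathcal{T}_n(x,s,q)=\sum_{j=0}^{\lfloor n/2\rfloor}q^{j^2}\frac{[n]_q}{[n-j]_q}\begin{bmatrix} n-j\\ j\end{bmatrix}_q\frac{(-q;q)_{n-j-1}}{(-q;q)_j}\,s^jx^{n-2j}\qquad(n>0).$$ For $n\ge 1$ and $0\le k\le\lfloor n/2\rfloor$, the incomplete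 $q$-Chebyshev polynomials of the first kind are $$\mathcal{T}_n^k(x,s,q)=\sum_{j=0}^{k}q^{j^2}\frac{[n]_q}{[n-j]_q}\begin{bmatrix} n-j\\ j\end{bmatrix}_q\frac{(-q;q)_{n-j-1}}{(-q;q)_j}\,s^jx^{n-2j}.$$ *)

theory Defs
  imports Complex_Main "HOL-Computational_Algebra.Polynomial"
begin

definition q_number :: "'a::field \<Rightarrow> nat \<Rightarrow> 'a" where
  "q_number q n = (1 - q ^ n) / (1 - q)"

definition q_pochhammer :: "'a::field \<Rightarrow> 'a \<Rightarrow> nat \<Rightarrow> 'a" where
  "q_pochhammer a q n = (\<Prod>i<n. 1 - q ^ i * a)"

definition q_binomial :: "'a::field \<Rightarrow> nat \<Rightarrow> nat \<Rightarrow> 'a" where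
  "q_binomial q n k =
     (if k \<le> n then q_pochhammer q q n / (q_pochhammer q q (n - k) * q_pochhammer q q k) else 0)"

text \<open>
  Polynomials in the two indeterminates \<open>x\<close> and \<open>s\<close> are elements of \<open>'a poly poly\<close>: the outer
  variable is \<open>x\<close>, the variable of the coefficient ring \<open>'a poly\<close> is \<open>s\<close>. Hence \<^const>\<open>pderiv\<close> is
  the derivative with respect to \<open>x\<close>, and \<open>smult [:c:]\<close> is multiplication by the scalar \<open>c\<close>.
\<close>

definition indet_x :: "'a::field poly poly" where
  "indet_x = [:0, 1:]"

definition indet_s :: "'a::field poly poly" where
  "indet_s = [:[:0, 1:]:]"

fun q_chebyshev_T :: "'a::field \<Rightarrow> nat \<Rightarrow> 'a poly poly" where
  "q_chebyshev_T q 0 = 1"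
| "q_chebyshev_T q (Suc 0) = indet_x"
| "q_chebyshev_T q (Suc (Suc n)) =
     smult [:1 + q ^ Suc n:] (indet_x * q_chebyshev_T q (Suc n))
     + smult [:q ^ Suc n:] (indet_s * q_chebyshev_T q n)"

text \<open>
  Meant for \<open>n \<ge> 1\<close> and \<open>k \<le> n div 2\<close>, where none of the natural number subtractions truncates.
\<close>

definition incomplete_q_chebyshev_T :: "'a::field \<Rightarrow> nat \<Rightarrow> nat \<Rightarrow> 'a poly poly" where
  "incomplete_q_chebyshev_T q n k =
     (\<Sum>j=0..k. smult
        [:q ^ (j ^ 2) * (q_number q n / q_number q (n - j)) * q_binomial q (n - j) j
          * (q_pochhammer (- q) q (n - j - 1) / q_pochhammer (- q) q j):]
        (indet_s ^ j * indet_x ^ (n - 2 * j)))"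

end

theory Submission
  imports Defs
begin

text \<open>
  Write \<open>t\<^sub>j = c(n,j) s\<^sup>j x\<^bsup>n-2j\<^esup>\<close> for the terms of the explicit formula of \<open>T\<^sub>n\<close>, and \<open>N\<close> for
  \<open>n div 2\<close>. In the sum of the incomplete polynomials \<open>t\<^sub>j\<close> occurs once for each \<open>k\<close> with
  \<open>j \<le> k \<le> N\<close>, that is, \<open>N - j + 1\<close> times. As \<open>x d/dx\<close> multiplies \<open>t\<^sub>j\<close> by \<open>n - 2j\<close>, the factor on
  the right-hand side is \<open>N - n/2 + 1 + (n - 2j)/2\<close>, the same number.

  What needs work is that the \<open>c(n,j)\<close> are the coefficients of the recursively defined \<open>T\<^sub>n\<close>
  (\<open>coeff_q_chebyshev_T\<close>). The products \<open>(q;q)\<^sub>k (-q;q)\<^sub>k = (q\<^sup>2;q\<^sup>2)\<^sub>k\<close> turn \<open>c(n,j)\<close> into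
  \<open>q\<^bsup>j*j\<^esup> (1 - q\<^sup>n) (q\<^sup>2;q\<^sup>2)\<^bsub>n-j-1\<^esub> / ((q;q)\<^bsub>n-2j\<^esub> (q\<^sup>2;q\<^sup>2)\<^sub>j)\<close>, and for these quotients the
  recurrence becomes, after cancellation, a polynomial identity in \<open>q\<close>, \<open>q\<^bsup>n-2j-1\<^esup>\<close> and
  \<open>q\<^bsup>j-1\<^esup>\<close> (\<open>reduced_coeff_Suc_Suc\<close>). This part holds over any field in which \<open>q\<close> is not a root of unity.
\<close>

section \<open>The coefficients of the explicit formula\<close>

text \<open>
  The coefficient of \<open>s\<^sup>j x\<^bsup>n-2j\<^esup>\<close> in the explicit formula, for \<open>n \<ge> 1\<close>. For \<open>n = 0\<close> the formula does
  not apply: the value is then \<open>0\<close> because \<open>[0]\<^sub>q = 0\<close>.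
\<close>
definition chebyshev_coeff :: "'a::field \<Rightarrow> nat \<Rightarrow> nat \<Rightarrow> 'a" where
  "chebyshev_coeff q n j =
     q ^ (j ^ 2) * (q_number q n / q_number q (n - j)) * q_binomial q (n - j) j
       * (q_pochhammer (- q) q (n - j - 1) / q_pochhammer (- q) q j)"

text \<open>The product \<open>(q\<^sup>2;q\<^sup>2)\<^sub>k = (q;q)\<^sub>k (-q;q)\<^sub>k\<close>.\<close>
definition pochhammer_sq :: "'a::field \<Rightarrow> nat \<Rightarrow> 'a" where
  "pochhammer_sq q k = q_pochhammer q q k * q_pochhammer (- q) q k"

text \<open>
  The coefficient of \<open>s\<^sup>j x\<^sup>a\<close> in reduced form, indexed by the two exponents, so that
  \<open>n = a + 2j\<close>; in this indexing the only subtraction left is \<open>n - j - 1 = a + j - 1\<close>. Meant for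
  \<open>a + j \<ge> 1\<close>, where it does not truncate.
\<close>
definition reduced_coeff :: "'a::field \<Rightarrow> nat \<Rightarrow> nat \<Rightarrow> 'a" where
  "reduced_coeff q a j =
     q ^ (j ^ 2) * (1 - q ^ (a + 2 * j)) * pochhammer_sq q (a + j - 1)
       / (q_pochhammer q q a * pochhammer_sq q j)"

lemma q_pochhammer_0 [simp]: "q_pochhammer a q 0 = 1"
  by (simp add: q_pochhammer_def)

lemma q_pochhammer_Suc: "q_pochhammer a q (Suc n) = q_pochhammer a q n * (1 - q ^ n * a)"
  by (simp add: q_pochhammer_def)

lemma pochhammer_sq_0 [simp]: "pochhammer_sq q 0 = 1"
  by (simp add: pochhammer_sq_def)

lemma pochhammer_sq_Suc:
  "pochhammer_sq q (Suc n) = pochhammer_sq q n * (1 - (q ^ Suc n) ^ 2)"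
  by (simp add: pochhammer_sq_def q_pochhammer_Suc algebra_simps power2_eq_square)

text \<open>
  The assumption makes every \<open>(q;q)\<^sub>n\<close> nonzero, and also every \<open>(-q;q)\<^sub>n\<close>: if \<open>q\<^sup>i = -1\<close>, then
  \<open>q\<^bsup>2i\<^esup> = 1\<close>.
\<close>
locale not_root_of_unity =
  fixes q :: "'a::field"
  assumes power_neq_1: "\<And>i. 0 < i \<Longrightarrow> q ^ i \<noteq> 1"
begin

lemma one_minus_power_neq_0: "1 - q ^ Suc n \<noteq> 0"
  using power_neq_1[of "Suc n"] by auto

lemma one_minus_power_sq_neq_0: "1 - (q ^ Suc n) ^ 2 \<noteq> 0"
  using power_neq_1[of "Suc n * 2"] unfolding power_mult by simp

lemma q_pochhammer_q_neq_0: "q_pochhammer q q n \<noteq> 0"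
  using one_minus_power_neq_0
  by (induction n) (simp_all add: q_pochhammer_Suc mult.commute)

lemma pochhammer_sq_neq_0: "pochhammer_sq q n \<noteq> 0"
  using one_minus_power_sq_neq_0
  by (induction n) (simp_all add: pochhammer_sq_Suc del: power_Suc)

lemma q_pochhammer_minus_q_neq_0: "q_pochhammer (- q) q n \<noteq> 0"
  using pochhammer_sq_neq_0[of n] by (auto simp: pochhammer_sq_def)

lemma chebyshev_coeff_eq_reduced_coeff:
  assumes "0 < a + j"
  shows "chebyshev_coeff q (a + 2 * j) j = reduced_coeff q a j"
proof -
  obtain m where m: "a + j = Suc m"
    using assms by (cases "a + j") auto
  have diff: "a + 2 * j - j = Suc m" "Suc m - j = a" "j \<le> Suc m"
    using m by auto
  have "1 - q \<noteq> 0" "1 - q ^ Suc m \<noteq> 0"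
    using one_minus_power_neq_0[of 0] one_minus_power_neq_0[of m] by auto
  \<comment> \<open>The denominator \<open>1 - q\<^bsup>n-j\<^esup>\<close> cancels against the last factor of \<open>(q;q)\<^bsub>n-j\<^esub>\<close>.\<close>
  then show ?thesis
    using q_pochhammer_q_neq_0[of j] q_pochhammer_q_neq_0[of a] q_pochhammer_minus_q_neq_0[of j]
    unfolding chebyshev_coeff_def reduced_coeff_def q_number_def q_binomial_def diff m
    by (simp add: diff q_pochhammer_Suc pochhammer_sq_def divide_simps mult.commute)
qed

section \<open>The recurrence for the coefficients\<close>

text \<open>
  On the coefficients, the recurrence of \<open>T\<^sub>n\<close> says
  \<open>c(a,j) = (1 + q\<^bsup>n-1\<^esup>) c(a-1,j) + q\<^bsup>n-1\<^esup> c(a,j-1)\<close> with \<open>n = a + 2j\<close>, where a term with a negative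
  index is dropped. The cases \<open>j = 0\<close> and \<open>a = 0\<close> come first, since one of the terms is then absent.
\<close>
lemma reduced_coeff_Suc_Suc_0:
  "reduced_coeff q (Suc (Suc b)) 0 = (1 + q ^ Suc b) * reduced_coeff q (Suc b) 0"
  using one_minus_power_neq_0[of b] one_minus_power_neq_0[of "Suc b"] q_pochhammer_q_neq_0[of b]
  by (simp add: reduced_coeff_def pochhammer_sq_Suc q_pochhammer_Suc divide_simps mult.commute)
     (simp add: algebra_simps power2_eq_square)

lemma reduced_coeff_0_Suc: "reduced_coeff q 0 (Suc j) = q ^ (Suc j ^ 2)"
  using one_minus_power_sq_neq_0[of j] pochhammer_sq_neq_0[of j]
  by (simp add: reduced_coeff_def pochhammer_sq_Suc power_mult[symmetric] mult.commute
      del: power_Suc)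

lemma reduced_coeff_0_Suc_Suc:
  "reduced_coeff q 0 (Suc (Suc k)) = q ^ (2 * k + 3) * reduced_coeff q 0 (Suc k)"
  unfolding reduced_coeff_0_Suc power_add[symmetric]
  by (rule arg_cong[of _ _ "power q"]) (simp add: power2_eq_square)

lemma reduced_coeff_Suc_Suc:
  "reduced_coeff q (Suc b) (Suc k) =
     (1 + q ^ (b + 2 * k + 2)) * reduced_coeff q b (Suc k)
     + q ^ (b + 2 * k + 2) * reduced_coeff q (Suc b) k"
proof -
  define A B where "A = q ^ b" and "B = q ^ k"
  define D where "D = pochhammer_sq q (b + k)"
  define P where "P = q_pochhammer q q b"
  define E where "E = pochhammer_sq q k"
  have u: "1 - A * q \<noteq> 0" and v: "1 - (B * q) ^ 2 \<noteq> 0"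
    using one_minus_power_neq_0[of b] one_minus_power_sq_neq_0[of k]
    by (auto simp: A_def B_def mult.commute)
  have double: "q ^ (k * 2) = q ^ k * q ^ k"
    by (simp add: power_mult power2_eq_square)
  have pow: "q ^ (b + 2 * k + 2) = A * B ^ 2 * q ^ 2" "q ^ (Suc b + 2 * k) = A * B ^ 2 * q"
    "q ^ (b + 2 * Suc k) = A * B ^ 2 * q ^ 2" "q ^ (Suc b + 2 * Suc k) = A * B ^ 2 * q ^ 3"
    "q ^ Suc (b + k) = A * B * q" "q ^ Suc k = B * q"
    "q ^ (Suc k ^ 2) = q ^ (k ^ 2) * B ^ 2 * q"
    by (simp_all add: A_def B_def power_add double power2_eq_square power3_eq_cube algebra_simps)
  have poch: "q_pochhammer q q (Suc b) = P * (1 - A * q)"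
      "pochhammer_sq q (Suc k) = E * (1 - (B * q) ^ 2)"
      "pochhammer_sq q (Suc (b + k)) = D * (1 - (A * B * q) ^ 2)"
    by (simp_all only: q_pochhammer_Suc pochhammer_sq_Suc pow A_def P_def E_def D_def)
  have idx: "Suc b + Suc k - 1 = Suc (b + k)" "b + Suc k - 1 = b + k" "Suc b + k - 1 = b + k"
    by auto
  \<comment> \<open>\<open>Z\<close> is a common factor: each of the three coefficients is \<open>Z\<close> times a polynomial in
    \<open>A\<close>, \<open>B\<close> and \<open>q\<close>.\<close>
  define Z where "Z = q ^ (k ^ 2) * D / (P * (1 - A * q) * (E * (1 - (B * q) ^ 2)))"
  have "reduced_coeff q (Suc b) (Suc k) =
      Z * (B ^ 2 * q * (1 - A * B ^ 2 * q ^ 3) * (1 - (A * B * q) ^ 2))"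
    unfolding reduced_coeff_def idx poch pow Z_def by (simp add: mult_ac)
  moreover have "reduced_coeff q b (Suc k) =
      Z * (B ^ 2 * q * (1 - A * B ^ 2 * q ^ 2) * (1 - A * q))"
    unfolding reduced_coeff_def idx poch pow Z_def using u
    by (simp add: D_def[symmetric] P_def[symmetric] mult_ac)
  moreover have "reduced_coeff q (Suc b) k = Z * ((1 - A * B ^ 2 * q) * (1 - (B * q) ^ 2))"
    unfolding reduced_coeff_def idx poch pow Z_def using v
    by (simp add: D_def[symmetric] E_def[symmetric] mult_ac)
  moreover have "B ^ 2 * q * (1 - A * B ^ 2 * q ^ 3) * (1 - (A * B * q) ^ 2) =
      (1 + A * B ^ 2 * q ^ 2) * (B ^ 2 * q * (1 - A * B ^ 2 * q ^ 2) * (1 - A * q))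
      + A * B ^ 2 * q ^ 2 * ((1 - A * B ^ 2 * q) * (1 - (B * q) ^ 2))"
    by algebra
  ultimately show ?thesis
    unfolding pow(1) by (simp only: distrib_left mult_ac)
qed

section \<open>The coefficients of the first kind polynomials\<close>

lemma coeff_coeff_q_chebyshev_T_Suc_Suc:
  "coeff (coeff (q_chebyshev_T q (Suc (Suc n))) i) j =
     (1 + q ^ Suc n) * (case i of 0 \<Rightarrow> 0 | Suc b \<Rightarrow> coeff (coeff (q_chebyshev_T q (Suc n)) b) j)
     + q ^ Suc n * (case j of 0 \<Rightarrow> 0 | Suc k \<Rightarrow> coeff (coeff (q_chebyshev_T q n) i) k)"
  by (simp add: indet_x_def indet_s_def coeff_pCons split: nat.split)

text \<open>The explicit formula for \<open>T\<^sub>n\<close>, coefficient by coefficient.\<close>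
lemma coeff_q_chebyshev_T:
  assumes "1 \<le> n"
  shows "coeff (coeff (q_chebyshev_T q n) i) j = (if i + 2 * j = n then reduced_coeff q i j else 0)"
  using assms
proof (induction n arbitrary: i j rule: less_induct)
  case (less n)
  consider "n = 1" | "n = 2" | m where "n = Suc (Suc (Suc m))"
    using less.prems by (metis One_nat_def Suc_1 not0_implies_Suc not_one_le_zero)
  then show ?case
  proof cases
    case 1
    have "1 - q \<noteq> 0"
      using one_minus_power_neq_0[of 0] by simp
    then have "reduced_coeff q 1 0 = 1"
      by (simp add: reduced_coeff_def q_pochhammer_Suc)
    moreover have "i + 2 * j = 1 \<longleftrightarrow> i = 1 \<and> j = 0"
      by presburger
    ultimately show ?thesis
      unfolding 1 by (auto simp: indet_x_def coeff_pCons split: nat.split)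
  next
    case 2
    have n: "n = Suc (Suc 0)"
      using 2 by simp
    have T1: "coeff (coeff (q_chebyshev_T q (Suc 0)) b) l =
        (if b + 2 * l = Suc 0 then reduced_coeff q b l else 0)" for b l
      by (rule less.IH) (simp_all add: n)
    \<comment> \<open>The recurrence leads to \<open>T\<^sub>0 = 1\<close> here, which the induction hypothesis does not cover.\<close>
    have T0: "coeff (coeff (q_chebyshev_T q 0) b) l = (if b = 0 \<and> l = 0 then 1 else 0)" for b l
      by (simp add: coeff_1)
    show ?thesis
      unfolding n coeff_coeff_q_chebyshev_T_Suc_Suc T1 T0
      by (cases i; cases j)
        (auto simp: reduced_coeff_Suc_Suc_0 reduced_coeff_0_Suc)
  next
    case (3 m)
    have T1: "coeff (coeff (q_chebyshev_T q (Suc (Suc m))) b) l =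
        (if b + 2 * l = Suc (Suc m) then reduced_coeff q b l else 0)" for b l
      by (rule less.IH) (simp_all add: 3)
    have T0: "coeff (coeff (q_chebyshev_T q (Suc m)) b) l =
        (if b + 2 * l = Suc m then reduced_coeff q b l else 0)" for b l
      by (rule less.IH) (simp_all add: 3)
    note rec = coeff_coeff_q_chebyshev_T_Suc_Suc[of "Suc m" i j]
    show ?thesis
    proof (cases "i + 2 * j = n")
      case False
      then show ?thesis
        unfolding 3 rec T1 T0 by (auto split: nat.split)
    next
      case True
      consider b where "i = Suc (Suc b)" "j = 0"
        | k where "i = 0" "j = Suc (Suc k)"
        | b k where "i = Suc b" "j = Suc k"
        using True 3 by (cases i; cases j; cases "i - 1"; cases "j - 1") auto
      then show ?thesis
      proof cases
        case (1 b)
        then have "b = Suc m"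
          using True 3 by simp
        then show ?thesis
          unfolding 3 rec T1 T0
          using 1 by (simp add: reduced_coeff_Suc_Suc_0 del: power_Suc)
      next
        case (2 k)
        then have "m = 2 * k + 1"
          using True 3 by simp
        then show ?thesis
          unfolding 3 rec T1 T0
          using 2 by (simp add: reduced_coeff_0_Suc_Suc eval_nat_numeral)
      next
        case (3 b k)
        then have "Suc (Suc m) = b + 2 * k + 2"
          using True \<open>n = _\<close> by simp
        then show ?thesis
          unfolding \<open>n = _\<close> rec T1 T0
          using 3 by (simp add: reduced_coeff_Suc_Suc del: power_Suc)
      qed
    qed
  qed
qed

end

section \<open>The coefficients of the incomplete polynomials\<close>

lemma coeff_coeff_monomial:
  "coeff (coeff (smult [:c:] (indet_s ^ l * indet_x ^ m)) i) j = (if i = m \<and> j = l then c else 0)"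
proof -
  have "indet_s ^ l = [:monom (1 :: 'a) l:]"
    by (simp add: indet_s_def poly_const_pow monom_altdef)
  moreover have "indet_x ^ m = monom (1 :: 'a poly) m"
    by (simp add: indet_x_def monom_altdef)
  ultimately show ?thesis
    by simp
qed

lemma coeff_incomplete_q_chebyshev_T:
  assumes "k \<le> n div 2"
  shows "coeff (coeff (incomplete_q_chebyshev_T q n k) i) j =
    (if j \<le> k \<and> i + 2 * j = n then chebyshev_coeff q n j else 0)"
proof -
  have "coeff (coeff (incomplete_q_chebyshev_T q n k) i) j =
      (\<Sum>l = 0..k. if l = j then if i + 2 * j = n then chebyshev_coeff q n j else 0 else 0)"
    unfolding incomplete_q_chebyshev_T_def coeff_sum coeff_coeff_monomial
    using assms by (intro sum.cong) (auto simp: chebyshev_coeff_def)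
  then show ?thesis
    by simp
qed

theorem theorem9:
  fixes q :: complex and n :: nat
  assumes "0 < norm q" and "norm q < 1" and "n \<ge> 1"
  shows "(\<Sum>k=0..n div 2. incomplete_q_chebyshev_T q n k) =
    smult [:of_nat (n div 2) - of_nat n / 2 + 1:] (q_chebyshev_T q n)
    + smult [:1 / 2:] (indet_x * pderiv (q_chebyshev_T q n))"
proof (intro poly_eqI)
  fix i j
  interpret not_root_of_unity q
  proof
    fix m :: nat assume "0 < m"
    then have "norm (q ^ m) < 1"
      using assms by (simp add: norm_power power_less_one_iff)
    then show "q ^ m \<noteq> 1"
      by auto
  qed
  define N where "N = n div 2"
  define c where "c = (if i + 2 * j = n then chebyshev_coeff q n j else 0)"
  have T: "coeff (coeff (q_chebyshev_T q n) i) j = c"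
    using assms chebyshev_coeff_eq_reduced_coeff[of i j]
    by (cases "0 < i + j") (auto simp: coeff_q_chebyshev_T c_def)
  \<comment> \<open>The operator \<open>x d/dx\<close> multiplies the coefficient of \<open>x\<^sup>i\<close> by \<open>i\<close>.\<close>
  have dT: "coeff (coeff (indet_x * pderiv (q_chebyshev_T q n)) i) j = of_nat i * c"
    unfolding T[symmetric]
    by (cases i) (simp_all add: indet_x_def coeff_pderiv of_nat_poly)
  have "coeff (coeff (\<Sum>k=0..N. incomplete_q_chebyshev_T q n k) i) j =
      (\<Sum>k=0..N. if j \<le> k then c else 0)"
    unfolding coeff_sum by (intro sum.cong) (auto simp: N_def c_def coeff_incomplete_q_chebyshev_T)
  also have "\<dots> = (\<Sum>k=j..N. c)"
    by (rule sum.mono_neutral_cong_right) auto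
  \<comment> \<open>With \<open>n = i + 2j\<close>, both sides are \<open>(N - j + 1) c\<close>.\<close>
  also have "\<dots> = (of_nat N - of_nat n / 2 + 1) * c + 1 / 2 * (of_nat i * c)"
  proof (cases "i + 2 * j = n")
    case True
    then have "j \<le> N"
      by (auto simp: N_def)
    then have "(\<Sum>k=j..N. c) = (of_nat N - of_nat j + 1) * c"
      by (simp add: of_nat_diff)
    moreover have "of_nat n = (of_nat i + 2 * of_nat j :: complex)"
      by (simp add: True[symmetric])
    ultimately show ?thesis
      by (simp add: algebra_simps add_divide_distrib)
  qed (simp add: c_def)
  finally show "coeff (coeff (\<Sum>k=0..n div 2. incomplete_q_chebyshev_T q n k) i) j =
      coeff (coeff (smult [:of_nat (n div 2) - of_nat n / 2 + 1:] (q_chebyshev_T q n)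
        + smult [:1 / 2:] (indet_x * pderiv (q_chebyshev_T q n))) i) j"
    by (simp add: T dT N_def)
qed

end
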